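(* If $G$ is a connected chordal graph with minimal tree representation $T$, then either $G$ is complete or $\mathrm{lpt}(G)\le f(T)$.
   Context: All graphs are finite and simple. A graph is chordal if each of its cycles on at least $4$ vertices has a chord. A tree representation of a chordal graph $G$ consists of a tree $T$ (the host tree) together with a (nonempty, connected) subtree $S(u)$ of $T$ for each $u\in V(G)$, such that distinct $u,v\in V(G)$ are adjacent in $G$ if and only if $S(u)$ and $S(v)$ share a vertex; the letter $T$ denotes both the host tree and the representation. A tree representation $T$ of $G$ is minimal if no tree representation of $G$ has a host tree with fewer than $|V(T)|$ vertices. A leaf is a vertex of degree $1$. For a tree $T$ on at least $2$ vertices, $f(T)$ is the maximum, over all edges $e\in E(T)$, of the minimum, over the two components $K$ of $T-e$, of the number of leaves of $T$ contained in $K$. ($f(T)$ is only needed when $|V(T)|\ge 2$; if $|V(T)|=1$ then $G$ is complete.) $\mathrm{lpt}(G)$ is the minimum size of a set of vertices of $G$ that intersects every longest path in $G$. *)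

theory Defs
  imports Main
begin

text \<open>A graph is given by its vertex set \<open>V\<close> and its set \<open>E\<close> of edges, an edge being a two-element
  set of vertices. All notions below are meant for pairs satisfying \<open>simple_graph\<close>.\<close>

definition simple_graph :: "'a set \<Rightarrow> 'a set set \<Rightarrow> bool" where
  "simple_graph V E \<longleftrightarrow> finite V \<and> (\<forall>e\<in>E. e \<subseteq> V \<and> card e = 2)"

definition adjacent :: "'a set set \<Rightarrow> 'a \<Rightarrow> 'a \<Rightarrow> bool" where
  "adjacent E u v \<longleftrightarrow> {u, v} \<in> E"

definition complete_graph :: "'a set \<Rightarrow> 'a set set \<Rightarrow> bool" where
  "complete_graph V E \<longleftrightarrow> (\<forall>u\<in>V. \<forall>v\<in>V. u \<noteq> v \<longrightarrow> adjacent E u v)"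

definition reachable :: "'a set set \<Rightarrow> 'a \<Rightarrow> 'a \<Rightarrow> bool" where
  "reachable E = (adjacent E)\<^sup>*\<^sup>*"

definition connected_graph :: "'a set \<Rightarrow> 'a set set \<Rightarrow> bool" where
  "connected_graph V E \<longleftrightarrow> V \<noteq> {} \<and> (\<forall>u\<in>V. \<forall>v\<in>V. reachable E u v)"

definition components :: "'a set \<Rightarrow> 'a set set \<Rightarrow> 'a set set" where
  "components V E = (\<lambda>v. {w \<in> V. reachable E v w}) ` V"

definition induced_edges :: "'a set set \<Rightarrow> 'a set \<Rightarrow> 'a set set" where
  "induced_edges E U = {e \<in> E. e \<subseteq> U}"

text \<open>A cycle is the list of its vertices in cyclic order, the first one not being repeated at the end.\<close>

definition cycle_edges :: "'a list \<Rightarrow> 'a set set" where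
  "cycle_edges c = {{c ! i, c ! (Suc i mod length c)} | i. i < length c}"

definition cycle :: "'a set \<Rightarrow> 'a set set \<Rightarrow> 'a list \<Rightarrow> bool" where
  "cycle V E c \<longleftrightarrow> 3 \<le> length c \<and> distinct c \<and> set c \<subseteq> V \<and> cycle_edges c \<subseteq> E"

definition has_chord :: "'a set set \<Rightarrow> 'a list \<Rightarrow> bool" where
  "has_chord E c \<longleftrightarrow> (\<exists>e\<in>E. e \<subseteq> set c \<and> e \<notin> cycle_edges c)"

definition chordal :: "'a set \<Rightarrow> 'a set set \<Rightarrow> bool" where
  "chordal V E \<longleftrightarrow> (\<forall>c. cycle V E c \<and> 4 \<le> length c \<longrightarrow> has_chord E c)"

definition tree :: "'a set \<Rightarrow> 'a set set \<Rightarrow> bool" where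
  "tree V E \<longleftrightarrow> simple_graph V E \<and> connected_graph V E \<and> \<not> (\<exists>c. cycle V E c)"

text \<open>A subtree is represented by its vertex set: a connected subgraph of a tree is an induced subgraph.\<close>

definition subtree :: "'t set \<Rightarrow> 't set set \<Rightarrow> 't set \<Rightarrow> bool" where
  "subtree N F U \<longleftrightarrow> U \<subseteq> N \<and> connected_graph U (induced_edges F U)"

text \<open>The host tree has vertex set \<open>N\<close> and edge set \<open>F\<close>; the values of \<open>S\<close> outside \<open>V\<close> are irrelevant.\<close>

definition tree_representation ::
    "'a set \<Rightarrow> 'a set set \<Rightarrow> 't set \<Rightarrow> 't set set \<Rightarrow> ('a \<Rightarrow> 't set) \<Rightarrow> bool" where
  "tree_representation V E N F S \<longleftrightarrow>
     tree N F \<and> (\<forall>u\<in>V. subtree N F (S u)) \<and>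
     (\<forall>u\<in>V. \<forall>v\<in>V. u \<noteq> v \<longrightarrow> (adjacent E u v \<longleftrightarrow> S u \<inter> S v \<noteq> {}))"

text \<open>The competing host trees live on the same type as \<open>N\<close>. This is no restriction: a tree
  with fewer vertices than \<open>N\<close>, on whatever type, is isomorphic to one with vertices in \<open>N\<close>.\<close>

definition minimal_tree_representation ::
    "'a set \<Rightarrow> 'a set set \<Rightarrow> 't set \<Rightarrow> 't set set \<Rightarrow> ('a \<Rightarrow> 't set) \<Rightarrow> bool" where
  "minimal_tree_representation V E N F S \<longleftrightarrow>
     tree_representation V E N F S \<and>
     \<not> (\<exists>(N' :: 't set) F' S'. tree_representation V E N' F' S' \<and> card N' < card N)"

definition degree :: "'a set set \<Rightarrow> 'a \<Rightarrow> nat" where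
  "degree E v = card {e \<in> E. v \<in> e}"

definition leaves :: "'a set \<Rightarrow> 'a set set \<Rightarrow> 'a set" where
  "leaves V E = {v \<in> V. degree E v = 1}"

text \<open>This is the parameter \<open>f\<close>. It is unspecified (\<open>Max {}\<close>) for a one-vertex tree.\<close>

definition leaf_split :: "'t set \<Rightarrow> 't set set \<Rightarrow> nat" where
  "leaf_split N F =
     Max ((\<lambda>e. Min ((\<lambda>K. card (leaves N F \<inter> K)) ` components N (F - {e}))) ` F)"

definition path :: "'a set \<Rightarrow> 'a set set \<Rightarrow> 'a list \<Rightarrow> bool" where
  "path V E p \<longleftrightarrow> p \<noteq> [] \<and> distinct p \<and> set p \<subseteq> V \<and> successively (adjacent E) p"

definition longest_path :: "'a set \<Rightarrow> 'a set set \<Rightarrow> 'a list \<Rightarrow> bool" where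
  "longest_path V E p \<longleftrightarrow> path V E p \<and> (\<forall>q. path V E q \<longrightarrow> length q \<le> length p)"

definition longest_path_transversal :: "'a set \<Rightarrow> 'a set set \<Rightarrow> 'a set \<Rightarrow> bool" where
  "longest_path_transversal V E X \<longleftrightarrow>
     X \<subseteq> V \<and> (\<forall>p. longest_path V E p \<longrightarrow> X \<inter> set p \<noteq> {})"

definition lpt :: "'a set \<Rightarrow> 'a set set \<Rightarrow> nat" where
  "lpt V E = (LEAST k. \<exists>X. longest_path_transversal V E X \<and> card X = k)"

end

theory Submission
  imports Defs
begin

text \<open>For an edge \<open>xy\<close> of the host tree let \<open>K\<close> be the component of \<open>T - xy\<close> containing \<open>y\<close>, and
  \<open>A\<close> the set of vertices \<open>v\<close> with \<open>x, y \<in> S v\<close>; minimality and connectedness make \<open>A\<close> nonempty.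
  Following the vertices of \<open>A\<close> that reach furthest towards each leaf, one finds \<open>W \<subseteq> A\<close>, no larger
  than the number of leaves in \<open>K\<close>, covering every node of \<open>K\<close> that \<open>A\<close> covers. A longest path \<open>Q\<close>
  avoiding \<open>W\<close> cannot step between a vertex living inside \<open>K\<close> and one that does not, as a vertex of
  \<open>W\<close> could be inserted there; so \<open>Q\<close> lives on one side of \<open>xy\<close>. If \<open>lpt\<close> exceeded \<open>f\<close>, every edge
  could thus be oriented towards the side of some such \<open>Q\<close>, and the orientation has a sink \<open>x\<close>.
  At the sink, for each neighbour \<open>y\<close> the path \<open>Q\<^sub>y\<close> starts with a segment \<open>p\<^sub>y\<close>, running up
  to its first vertex containing \<open>x\<close>, that lies in the direction of some neighbour \<open>z \<noteq> y\<close>. Some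
  \<open>w \<in> W\<^sub>z\<close> joins \<open>p\<^sub>y\<close> to \<open>Q\<^sub>z\<close> in place of \<open>p\<^sub>z\<close>, and as \<open>Q\<^sub>z\<close> is longest, \<open>p\<^sub>z\<close> is longer
  than \<open>p\<^sub>y\<close>. Iterating this gives arbitrarily long segments, which is absurd.\<close>

subsection \<open>Paths\<close>

lemma adjacent_sym: "adjacent E u v \<longleftrightarrow> adjacent E v u"
  by (simp add: adjacent_def insert_commute)

lemma reachable_refl [simp]: "reachable E u u"
  by (simp add: reachable_def)

lemma reachable_step: "reachable E u v \<Longrightarrow> adjacent E v w \<Longrightarrow> reachable E u w"
  unfolding reachable_def by (rule rtranclp.rtrancl_into_rtrancl)

lemma reachable_trans: "reachable E u v \<Longrightarrow> reachable E v w \<Longrightarrow> reachable E u w"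
  unfolding reachable_def by (rule rtranclp_trans)

lemma reachable_sym: "reachable E u v \<Longrightarrow> reachable E v u"
  unfolding reachable_def
  by (metis adjacent_sym sympD sympI symp_rtranclp)

lemma reachable_induct [consumes 1, case_names refl step]:
  assumes "reachable E u v" and "P u"
    and "\<And>v w. reachable E u v \<Longrightarrow> adjacent E v w \<Longrightarrow> P v \<Longrightarrow> P w"
  shows "P v"
  using assms unfolding reachable_def by (induction rule: rtranclp_induct) auto

lemma successively_rev_adjacent:
  "successively (adjacent E) (rev p) \<longleftrightarrow> successively (adjacent E) p"
proof -
  have "(\<lambda>x y. adjacent E y x) = adjacent E" by (intro ext) (rule adjacent_sym)
  then show ?thesis by (simp only: successively_rev)
qed

text \<open>The path runs backwards, from \<open>v\<close> to \<open>u\<close>, so that following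
  one more edge conses a vertex in front; if that vertex is already on the path, everything before
  it is dropped.\<close>

lemma reachable_imp_path:
  assumes "reachable E u v"
  obtains p where "p \<noteq> []" "hd p = v" "last p = u" "distinct p" "successively (adjacent E) p"
proof -
  from assms have "\<exists>p. p \<noteq> [] \<and> hd p = v \<and> last p = u \<and> distinct p \<and> successively (adjacent E) p"
  proof (induction rule: reachable_induct)
    case refl
    have "[u] \<noteq> [] \<and> hd [u] = u \<and> last [u] = u \<and> distinct [u] \<and> successively (adjacent E) [u]"
      by simp
    then show ?case by blast
  next
    case (step v w)
    then obtain p where p: "p \<noteq> []" "hd p = v" "last p = u" "distinct p" "successively (adjacent E) p"
      by blast
    show ?case
    proof (cases "w \<in> set p")
      case True
      then obtain a b where "p = a @ w # b" by (metis split_list)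
      then have "w # b \<noteq> [] \<and> hd (w # b) = w \<and> last (w # b) = u \<and> distinct (w # b)
          \<and> successively (adjacent E) (w # b)"
        using p by (auto simp: successively_append_iff)
      then show ?thesis by blast
    next
      case False
      then have "w # p \<noteq> [] \<and> hd (w # p) = w \<and> last (w # p) = u \<and> distinct (w # p)
          \<and> successively (adjacent E) (w # p)"
        using p step.hyps by (auto simp: successively_Cons adjacent_sym)
      then show ?thesis by blast
    qed
  qed
  then show ?thesis using that by blast
qed

lemma successively_nth: "successively R p \<Longrightarrow> Suc i < length p \<Longrightarrow> R (p ! i) (p ! Suc i)"
  by (simp add: successively_conv_nth)

text \<open>A scan along \<open>p\<close> stops at the first consecutive pair on which
  \<open>Q\<close> changes. The order of \<open>a\<close> and \<open>b\<close> on \<open>p\<close>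
  is unknown, so the direction of the change is left open.\<close>

lemma successively_exists_change:
  assumes "successively R p" "a \<in> set p" "Q a" "b \<in> set p" "\<not> Q b" "symp R"
  obtains xs c d ys where "p = xs @ c # d # ys" "R c d" "Q c \<noteq> Q d"
proof -
  have "\<exists>xs c d ys. p = xs @ c # d # ys \<and> R c d \<and> Q c \<noteq> Q d"
    using assms(1,2,4) assms(3,5)
  proof (induction p arbitrary: a b)
    case Nil
    then show ?case by simp
  next
    case (Cons c p)
    show ?case
    proof (cases p)
      case Nil
      then show ?thesis using Cons.prems by auto
    next
      case (Cons d q)
      show ?thesis
      proof (cases "Q c = Q d")
        case True
        then have "\<exists>a\<in>set p. Q a" "\<exists>b\<in>set p. \<not> Q b"
          using Cons.prems \<open>p = d # q\<close> by auto
        moreover have "successively R p"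
          using Cons.prems(1) \<open>p = d # q\<close> by simp
        ultimately obtain xs c' d' ys where "p = xs @ c' # d' # ys" "R c' d'" "Q c' \<noteq> Q d'"
          using Cons.IH by blast
        then show ?thesis by (metis append_Cons)
      next
        case False
        have "c # p = [] @ c # d # q" "R c d"
          using Cons.prems(1) \<open>p = d # q\<close> by auto
        then show ?thesis using False by blast
      qed
    qed
  qed
  then show ?thesis using that by blast
qed

lemma longest_path_rev: "longest_path V E p \<Longrightarrow> longest_path V E (rev p)"
  by (simp add: longest_path_def path_def successively_rev_adjacent del: successively_rev)

lemma longest_path_length_eq:
  "longest_path V E p \<Longrightarrow> longest_path V E q \<Longrightarrow> length p = length q"
  by (simp add: longest_path_def le_antisym)

text \<open>Reversing the path if necessary puts the longer part behind \<open>a\<close>, ready for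
  gluing at \<open>a\<close>.\<close>

lemma longest_path_split_suffix:
  assumes "longest_path V E p" "a \<in> set p"
  obtains u v p' where "longest_path V E p'" "set p' = set p" "p' = u @ a # v" "length u \<le> length v"
proof -
  obtain u v where uv: "p = u @ a # v" using assms(2) by (metis split_list)
  show ?thesis
  proof (cases "length u \<le> length v")
    case True
    then show ?thesis using that[of p u v] assms uv by simp
  next
    case False
    then show ?thesis
      using that[OF longest_path_rev[OF assms(1)], of "rev v" "rev u"] uv by auto
  qed
qed

text \<open>Two disjoint longest paths could be linked by a shortest path between them; the link and
  the longer half of each would form a longer path.\<close>

lemma longest_paths_intersect:
  assumes G: "simple_graph V E" "connected_graph V E"
    and P: "longest_path V E P" and Q: "longest_path V E Q"
  shows "set P \<inter> set Q \<noteq> {}"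
proof
  assume disj: "set P \<inter> set Q = {}"
  define joins where "joins r \<longleftrightarrow> r \<noteq> [] \<and> hd r \<in> set P \<and> last r \<in> set Q \<and> distinct r
    \<and> successively (adjacent E) r" for r
  have ne: "P \<noteq> []" "Q \<noteq> []" "set P \<subseteq> V" "set Q \<subseteq> V"
    using P Q by (auto simp: longest_path_def path_def)
  then have "reachable E (hd Q) (hd P)"
    using G(2) unfolding connected_graph_def by (metis hd_in_set subsetD)
  then obtain r0 where "joins r0"
    unfolding joins_def using reachable_imp_path ne hd_in_set by metis
  then obtain r where r: "joins r" and min: "\<And>s. joins s \<Longrightarrow> length r \<le> length s"
    using ex_has_least_nat[of joins r0 length] by blast
  obtain a s where as: "r = a # s" using r by (cases r) (auto simp: joins_def)
  have "s \<noteq> []" using r disj as by (auto simp: joins_def)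
  then obtain m b where sm: "s = m @ [b]" by (metis append_butlast_last_id)
  have aP: "a \<in> set P" and bQ: "b \<in> set Q" and rd: "distinct (a # m @ [b])"
    and rs: "successively (adjacent E) (a # m @ [b])"
    using r as sm by (auto simp: joins_def)
  \<comment> \<open>By minimality of \<open>r\<close>, its interior meets neither \<open>P\<close>
    nor \<open>Q\<close>: cutting at such a vertex would leave a shorter link.\<close>
  have mP: "c \<notin> set P" if c: "c \<in> set m" for c
  proof
    assume "c \<in> set P"
    obtain m1 m2 where m: "m = m1 @ c # m2" using c by (metis split_list)
    then have "joins (c # m2 @ [b])"
      using \<open>c \<in> set P\<close> bQ rd rs unfolding joins_def
      by (auto simp: successively_append_iff successively_Cons)
    then show False using min m as sm by fastforce
  qed
  have mQ: "c \<notin> set Q" if c: "c \<in> set m" for c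
  proof
    assume "c \<in> set Q"
    obtain m1 m2 where m: "m = m1 @ c # m2" using c by (metis split_list)
    then have "joins (a # m1 @ [c])"
      using \<open>c \<in> set Q\<close> aP rd rs successively_append_iff[of "adjacent E" "a # m1 @ [c]" "m2 @ [b]"]
      unfolding joins_def by auto
    then show False using min m as sm by fastforce
  qed
  obtain P' v u where P': "longest_path V E P'" "set P' = set P" "P' = v @ a # u" "length v \<le> length u"
    using longest_path_split_suffix[OF P aP] by metis
  obtain Q' v' u' where Q': "longest_path V E Q'" "set Q' = set Q" "Q' = v' @ b # u'" "length v' \<le> length u'"
    using longest_path_split_suffix[OF Q bQ] by metis
  \<comment> \<open>Each of \<open>u\<close> and \<open>u'\<close> has at least half of the
    \<open>length P - 1\<close> vertices other than the attaching one, so with \<open>a\<close> and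
    \<open>b\<close> the list \<open>R\<close> has more than \<open>length P\<close>
    vertices.\<close>
  define R where "R = rev u @ (a # m @ [b]) @ u'"
  have mV: "set m \<subseteq> V"
  proof
    fix c assume "c \<in> set m"
    then obtain m1 m2 where "m = m1 @ c # m2" by (metis split_list)
    then have "adjacent E c (hd (m2 @ [b]))"
      using rs by (auto simp: successively_append_iff successively_Cons)
    then show "c \<in> V" using G(1) by (auto simp: simple_graph_def adjacent_def)
  qed
  have join: "successively (adjacent E) (xs @ ys @ zs)"
    if "successively (adjacent E) (xs @ [hd ys])" "successively (adjacent E) ys"
      "successively (adjacent E) (last ys # zs)" "ys \<noteq> []" for xs ys zs
    using that by (auto simp: successively_append_iff successively_Cons)
  have "successively (adjacent E) (a # u)" "successively (adjacent E) (b # u')"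
    using P'(1,3) Q'(1,3) by (auto simp: longest_path_def path_def successively_append_iff)
  then have "successively (adjacent E) R"
    unfolding R_def using rs successively_rev_adjacent[of E "a # u"]
    by (intro join) (simp_all del: successively_rev)
  moreover have "distinct R"
  proof -
    have "distinct P'" "distinct Q'" using P' Q' by (auto simp: longest_path_def path_def)
    moreover have "set P' \<inter> set Q' = {}" "set m \<inter> set P' = {}" "set m \<inter> set Q' = {}"
      using disj P'(2) Q'(2) mP mQ by auto
    ultimately show ?thesis unfolding R_def P'(3) Q'(3) using rd by auto
  qed
  moreover have "set R \<subseteq> V"
    unfolding R_def using mV ne P' Q' by auto
  ultimately have "path V E R" by (simp add: path_def R_def)
  then have "length R \<le> length P" using P by (simp add: longest_path_def)
  moreover have "length P' = length P" "length Q' = length P"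
    using longest_path_length_eq P P'(1) Q'(1) by blast+
  ultimately show False using P'(3,4) Q'(3,4) by (simp add: R_def)
qed

lemma longest_path_no_insert:
  assumes "longest_path V E (xs @ a # b # ys)" "w \<in> V" "adjacent E a w" "adjacent E w b"
  shows "w \<in> set (xs @ a # b # ys)"
proof (rule ccontr)
  assume "w \<notin> set (xs @ a # b # ys)"
  then have "path V E (xs @ a # w # b # ys)"
    using assms by (auto simp: longest_path_def path_def successively_append_iff successively_Cons)
  then show False using assms(1) unfolding longest_path_def by fastforce
qed

subsection \<open>Host trees\<close>

text \<open>The component ahead when the edge is traversed from \<open>x\<close> to
  \<open>y\<close>; the other component of the tree minus this edge is
  \<open>side F y x\<close>.\<close>

definition side :: "'t set set \<Rightarrow> 't \<Rightarrow> 't \<Rightarrow> 't set" where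
  "side F x y = {t. reachable (F - {{x, y}}) y t}"

lemma side_refl [simp]: "y \<in> side F x y"
  by (simp add: side_def)

lemma side_step:
  assumes "t \<in> side F x y" "adjacent F t t'" "t' \<notin> side F x y"
  shows "t = y \<and> t' = x \<or> t = x \<and> t' = y"
proof (rule ccontr)
  assume "\<not> ?thesis"
  then have "adjacent (F - {{x, y}}) t t'"
    using assms(2) by (auto simp: adjacent_def doubleton_eq_iff)
  then show False using assms(1,3) reachable_step unfolding side_def by fast
qed

locale host_tree =
  fixes N :: "'t set" and F :: "'t set set"
  assumes tree: "tree N F"
begin

lemma simple: "simple_graph N F" and connected: "connected_graph N F"
  using tree by (auto simp: tree_def)

lemma finite_nodes: "finite N"
  using simple by (simp add: simple_graph_def)

lemma finite_edges: "finite F"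
proof -
  have "F \<subseteq> Pow N" using simple by (auto simp: simple_graph_def)
  then show ?thesis using finite_nodes finite_subset by blast
qed

lemma adjacentD:
  assumes "adjacent F x y" shows "x \<in> N" "y \<in> N" "x \<noteq> y"
  using assms simple by (auto simp: adjacent_def simple_graph_def)

lemma edgeE:
  assumes "e \<in> F" obtains x y where "e = {x, y}" "adjacent F x y"
proof -
  have "card e = 2" using assms simple by (simp add: simple_graph_def)
  then obtain x y where "e = {x, y}" by (metis card_2_iff)
  then show ?thesis using that assms by (simp add: adjacent_def)
qed

text \<open>A path from \<open>x\<close> to \<open>y\<close> avoiding the edge \<open>{x, y}\<close>
  would close up with it to a cycle.\<close>

lemma bridge:
  assumes xy: "adjacent F x y" shows "x \<notin> side F x y"
proof
  let ?F = "F - {{x, y}}"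
  assume "x \<in> side F x y"
  then have "reachable ?F y x" by (simp add: side_def)
  then obtain p where p: "p \<noteq> []" "hd p = x" "last p = y" "distinct p" "successively (adjacent ?F) p"
    by (rule reachable_imp_path)
  obtain q where q: "p = x # q" using p by (cases p) auto
  have "q \<noteq> []" using p q adjacentD(3)[OF xy] by auto
  then obtain z q' where zq: "q = z # q'" by (cases q) auto
  \<comment> \<open>A path with only the vertices \<open>x\<close> and \<open>y\<close> would use
    the deleted edge; hence there are at least three.\<close>
  have "q' \<noteq> []" using p q zq by (auto simp: adjacent_def)
  then have len: "3 \<le> length p" using q zq by (cases q') auto
  have edge: "{p ! i, p ! (Suc i mod length p)} \<in> F" if i: "i < length p" for i
  proof (cases "Suc i < length p")
    case True
    then have "adjacent ?F (p ! i) (p ! Suc i)" using successively_nth p(5) by fast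
    then show ?thesis using True by (simp add: adjacent_def)
  next
    case False
    then have "Suc i = length p" using i by simp
    \<comment> \<open>The wrap-around index is where the deleted edge \<open>{x, y}\<close> closes
      the cycle.\<close>
    then have "i = length p - 1" "Suc i mod length p = 0" by simp_all
    then have "p ! i = y" "p ! (Suc i mod length p) = x"
      using p by (simp_all add: last_conv_nth hd_conv_nth)
    then show ?thesis using xy by (simp add: adjacent_def insert_commute)
  qed
  have "set p \<subseteq> N"
  proof
    fix t assume "t \<in> set p"
    then obtain i where "i < length p" "p ! i = t" by (metis in_set_conv_nth)
    then show "t \<in> N" using edge[of i] simple by (auto simp: simple_graph_def)
  qed
  then have "cycle N F p" using len p(4) edge by (auto simp: cycle_def cycle_edges_def)
  then show False using tree by (auto simp: tree_def)
qed

lemma side_subset: "adjacent F x y \<Longrightarrow> side F x y \<subseteq> N"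
proof
  fix t assume xy: "adjacent F x y" and "t \<in> side F x y"
  then have "reachable (F - {{x, y}}) y t" by (simp add: side_def)
  then show "t \<in> N"
  proof (induction rule: reachable_induct)
    case (step v w)
    then have "adjacent F v w" by (simp add: adjacent_def)
    then show ?case by (rule adjacentD)
  qed (rule adjacentD[OF xy])
qed

lemma sides_disjoint:
  assumes "adjacent F x y" shows "side F x y \<inter> side F y x = {}"
proof -
  have "reachable (F - {{x, y}}) y x" if "t \<in> side F x y" "t \<in> side F y x" for t
  proof -
    have "reachable (F - {{x, y}}) y t" "reachable (F - {{x, y}}) x t"
      using that by (simp_all add: side_def insert_commute)
    then show ?thesis by (blast intro: reachable_trans reachable_sym)
  qed
  then show ?thesis using bridge[OF assms] by (auto simp: side_def)
qed

lemma sides_cover: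
  assumes "adjacent F x y" "t \<in> N" shows "t \<in> side F x y \<or> t \<in> side F y x"
proof -
  have "reachable F x t"
    using connected assms adjacentD by (auto simp: connected_graph_def)
  then show ?thesis
  proof (induction rule: reachable_induct)
    case (step v w)
    have "w = x \<or> w = y"
      if "w \<notin> side F x y" "w \<notin> side F y x"
      using step.IH step.hyps(2) side_step[of v F x y w] side_step[of v F y x w] that by blast
    then show ?case using side_refl[of y F x] side_refl[of x F y] by blast
  qed simp
qed

lemma crossing:
  assumes xy: "adjacent F x y" and "t \<in> side F x y" "adjacent F t t'" "t' \<notin> side F x y"
  shows "t = y" "t' = x"
  using side_step[OF assms(2-4)] bridge[OF xy] assms(2) by auto

text \<open>A walk inside \<open>U\<close> from \<open>s\<close> to \<open>t\<close> has to leave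
  the side, and the edge between \<open>x\<close> and \<open>y\<close> is the only exit.\<close>

lemma subtree_crossing:
  assumes xy: "adjacent F x y" and U: "subtree N F U"
    and "s \<in> U" "s \<in> side F x y" "t \<in> U" "t \<notin> side F x y"
  shows "x \<in> U" "y \<in> U"
proof -
  have "reachable (induced_edges F U) s t"
    using U assms by (auto simp: subtree_def connected_graph_def)
  then have "t \<in> side F x y \<or> (x \<in> U \<and> y \<in> U)"
  proof (induction rule: reachable_induct)
    case (step v w)
    then have "adjacent F v w" "v \<in> U" "w \<in> U"
      by (auto simp: adjacent_def induced_edges_def)
    then show ?case using step.IH crossing[OF xy, of v w] by blast
  qed (simp add: assms)
  then show "x \<in> U" "y \<in> U" using assms by auto
qed

text \<open>A walk from \<open>z\<close> that avoids the edge \<open>yz\<close> never comes back to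
  \<open>y\<close>, so it cannot escape over the edge \<open>xy\<close>.\<close>

lemma side_mono:
  assumes xy: "adjacent F x y" and yz: "adjacent F y z" and "z \<noteq> x"
  shows "side F y z \<subseteq> side F x y"
proof
  fix t assume "t \<in> side F y z"
  then have "reachable (F - {{y, z}}) z t" by (simp add: side_def)
  then show "t \<in> side F x y"
  proof (induction rule: reachable_induct)
    case refl
    show ?case
    proof (rule ccontr)
      assume "z \<notin> side F x y"
      then show False using crossing(2)[OF xy side_refl yz] assms by simp
    qed
  next
    case (step v w)
    have "v \<noteq> y" using step.hyps(1) bridge[OF yz] by (auto simp: side_def)
    moreover have "adjacent F v w" using step.hyps by (simp add: adjacent_def)
    ultimately show ?case using crossing(1)[OF xy step.IH] by blast
  qed
qed

text \<open>Moving on to the next edge loses at least \<open>y\<close>; this makes the size of a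
  side decrease in the inductions and the descent below.\<close>

lemma side_psubset:
  assumes "adjacent F x y" "adjacent F y z" "z \<noteq> x"
  shows "side F y z \<subset> side F x y"
  using side_mono[OF assms] bridge[OF assms(2)] side_refl[of y F x] by blast

text \<open>The branch at \<open>z'\<close> lies in \<open>side F z y\<close>, the component of the
  tree minus \<open>yz\<close> that is opposite to \<open>side F y z\<close>.\<close>

lemma child_sides_disjoint:
  assumes "adjacent F y z" "adjacent F y z'" "z \<noteq> z'"
  shows "side F y z \<inter> side F y z' = {}"
  using side_mono[of z y z'] sides_disjoint[of y z] assms by (auto simp: adjacent_sym)

lemma child_sides_cover:
  assumes xy: "adjacent F x y" and "t \<in> side F x y" "t \<noteq> y"
  obtains z where "adjacent F y z" "z \<noteq> x" "t \<in> side F y z"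
proof -
  have "reachable (F - {{x, y}}) y t" using assms by (simp add: side_def)
  then have "t = y \<or> (\<exists>z. adjacent F y z \<and> z \<noteq> x \<and> t \<in> side F y z)"
  proof (induction rule: reachable_induct)
    case (step v w)
    have vw: "adjacent F v w" and ne: "{v, w} \<noteq> {x, y}"
      using step.hyps by (auto simp: adjacent_def)
    from step.IH show ?case
    proof
      assume "v = y"
      then have "adjacent F y w" "w \<noteq> x" using vw ne by auto
      then show ?thesis using side_refl[of w F y] by blast
    next
      assume "\<exists>z. adjacent F y z \<and> z \<noteq> x \<and> v \<in> side F y z"
      then obtain z where "adjacent F y z" "z \<noteq> x" "v \<in> side F y z" by blast
      then show ?thesis using crossing(2)[of y z v w] vw by blast
    qed
  qed simp
  then show ?thesis using that assms by blast
qed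

text \<open>Take the branch at \<open>x\<close> that contains some node of \<open>U\<close>; leaving
  this branch would put \<open>x\<close> into \<open>U\<close>.\<close>

lemma avoiding_subtree_in_side:
  assumes U: "subtree N F U" and "x \<in> N" "x \<notin> U"
  obtains y where "adjacent F x y" "U \<subseteq> side F x y"
proof -
  obtain t where t: "t \<in> U" using U by (auto simp: subtree_def connected_graph_def)
  then have "t \<in> N" using U by (auto simp: subtree_def)
  then have "reachable F x t" using connected assms by (auto simp: connected_graph_def)
  then have "t = x \<or> (\<exists>y. adjacent F x y \<and> t \<in> side F x y)"
  proof (induction rule: reachable_induct)
    case (step v w)
    from step.IH show ?case
    proof
      assume "v = x"
      then show ?thesis using step.hyps(2) side_refl[of w F x] by blast
    next
      assume "\<exists>y. adjacent F x y \<and> v \<in> side F x y"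
      then obtain y where "adjacent F x y" "v \<in> side F x y" by blast
      then show ?thesis using crossing(2)[of x y v w] step.hyps(2) by blast
    qed
  qed simp
  then obtain y where y: "adjacent F x y" "t \<in> side F x y" using t assms by auto
  have "U \<subseteq> side F x y" using subtree_crossing(1)[OF y(1) U t y(2)] assms by blast
  then show ?thesis using that y by blast
qed

section \<open>Leaves on the two sides of an edge\<close>

lemma side_has_leaf:
  assumes "adjacent F x y" shows "leaves N F \<inter> side F x y \<noteq> {}"
  using assms
proof (induction "card (side F x y)" arbitrary: x y rule: less_induct)
  case less
  have fin: "finite (side F x y)" by (rule finite_subset[OF side_subset[OF less.prems] finite_nodes])
  show ?case
  proof (cases "\<exists>z. adjacent F y z \<and> z \<noteq> x")
    case True
    then obtain z where z: "adjacent F y z" "z \<noteq> x" by blast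
    have sub: "side F y z \<subset> side F x y" by (rule side_psubset[OF less.prems z])
    have "leaves N F \<inter> side F y z \<noteq> {}"
      by (rule less.hyps[OF psubset_card_mono[OF fin sub] z(1)])
    then show ?thesis using sub by auto
  next
    \<comment> \<open>The search away from \<open>x\<close> ends here: \<open>y\<close> has no
      neighbour but \<open>x\<close> and is itself the leaf.\<close>
    case False
    have "{e \<in> F. y \<in> e} = {{x, y}}"
    proof (intro equalityI subsetI)
      fix e assume "e \<in> {e \<in> F. y \<in> e}"
      then have e: "e \<in> F" "y \<in> e" by auto
      obtain a b where ab: "e = {a, b}" "adjacent F a b" using e(1) by (rule edgeE)
      then have "a = y \<and> b = x \<or> b = y \<and> a = x"
        using False e(2) adjacent_sym[of F a b] by auto
      then show "e \<in> {{x, y}}" using ab(1) by auto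
    next
      fix e assume "e \<in> {{x, y}}"
      then show "e \<in> {e \<in> F. y \<in> e}" using less.prems by (simp add: adjacent_def)
    qed
    then have "y \<in> leaves N F"
      using adjacentD[OF less.prems] by (simp add: leaves_def degree_def)
    then show ?thesis using side_refl[of y F x] by blast
  qed
qed

lemma side_component:
  assumes xy: "adjacent F x y" and v: "v \<in> side F x y"
  shows "{w \<in> N. reachable (F - {{x, y}}) v w} = side F x y"
proof -
  have yv: "reachable (F - {{x, y}}) y v" using v by (simp add: side_def)
  have "reachable (F - {{x, y}}) v w \<longleftrightarrow> w \<in> side F x y" for w
    using yv unfolding side_def by (blast intro: reachable_trans reachable_sym)
  then show ?thesis using side_subset[OF xy] by blast
qed

text \<open>The components of the tree minus the edge are its two sides, and the smaller of their
  leaf counts is one of the values whose maximum is \<open>leaf_split\<close>.\<close>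

lemma few_leaves_side:
  assumes xy: "adjacent F x y"
  shows "card (leaves N F \<inter> side F x y) \<le> leaf_split N F
       \<or> card (leaves N F \<inter> side F y x) \<le> leaf_split N F"
proof -
  let ?g = "\<lambda>e. (\<lambda>K. card (leaves N F \<inter> K)) ` components N (F - {e})"
  let ?e = "{x, y}"
  have "Min (?g ?e) \<in> ?g ?e"
    using adjacentD[OF xy] finite_nodes by (intro Min_in) (auto simp: components_def)
  then obtain v where v: "v \<in> N"
    and eq: "Min (?g ?e) = card (leaves N F \<inter> {w \<in> N. reachable (F - {?e}) v w})"
    by (auto simp: components_def)
  have "Min (?g ?e) \<le> leaf_split N F"
    unfolding leaf_split_def using finite_edges xy by (intro Max_ge) (auto simp: adjacent_def)
  moreover have "{w \<in> N. reachable (F - {?e}) v w} \<in> {side F x y, side F y x}"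
    using sides_cover[OF xy v] side_component[OF xy] side_component[of y x] xy
    by (auto simp: adjacent_sym insert_commute)
  ultimately show ?thesis using eq by auto
qed

end

subsection \<open>Tree representations\<close>

locale represented_graph = host_tree N F
  for V :: "'a set" and E :: "'a set set" and N :: "'t set" and F and S :: "'a \<Rightarrow> 't set" +
  assumes simple_G: "simple_graph V E" and connected_G: "connected_graph V E"
    and min_rep: "minimal_tree_representation V E N F S"
begin

lemma rep: "tree_representation V E N F S"
  using min_rep by (simp add: minimal_tree_representation_def)

lemma subtree_S: "v \<in> V \<Longrightarrow> subtree N F (S v)"
  using rep by (simp add: tree_representation_def)

lemma S_subset: "v \<in> V \<Longrightarrow> S v \<subseteq> N" and S_nonempty: "v \<in> V \<Longrightarrow> S v \<noteq> {}"
  using subtree_S by (auto simp: subtree_def connected_graph_def)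

lemma adjacentI: "u \<in> V \<Longrightarrow> v \<in> V \<Longrightarrow> u \<noteq> v \<Longrightarrow> t \<in> S u \<Longrightarrow> t \<in> S v \<Longrightarrow> adjacent E u v"
  using rep by (auto simp: tree_representation_def)

lemma adjacentE:
  assumes "adjacent E u v"
  obtains t where "u \<in> V" "v \<in> V" "u \<noteq> v" "t \<in> S u" "t \<in> S v"
proof -
  have "u \<in> V" "v \<in> V" "u \<noteq> v"
    using assms simple_G by (auto simp: adjacent_def simple_graph_def)
  then show ?thesis using that assms rep by (auto simp: tree_representation_def)
qed

text \<open>In terms of tree decompositions, the intersection of the bags of \<open>x\<close> and
  \<open>y\<close>: for an edge \<open>xy\<close>, the set separating the vertices living strictly
  on either side.\<close>

definition adhesion :: "'t \<Rightarrow> 't \<Rightarrow> 'a set" where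
  "adhesion x y = {v \<in> V. x \<in> S v \<and> y \<in> S v}"

lemma adhesionI:
  assumes "adjacent F x y" "v \<in> V" "s \<in> S v" "s \<in> side F x y" "t \<in> S v" "t \<notin> side F x y"
  shows "v \<in> adhesion x y"
  using subtree_crossing[OF assms(1) subtree_S[OF assms(2)] assms(3-6)] assms(2)
  by (simp add: adhesion_def)

lemma restrict_to_side:
  assumes xy: "adjacent F x y" and sub: "\<And>v. v \<in> V \<Longrightarrow> S v \<subseteq> side F x y"
  shows "tree_representation V E (side F x y) (induced_edges F (side F x y)) S"
proof -
  let ?K = "side F x y"
  let ?F = "induced_edges F ?K"
  have K: "?K \<subseteq> N" by (rule side_subset[OF xy])
  have reach: "reachable ?F y t" if "t \<in> ?K" for t
  proof -
    have "reachable (F - {{x, y}}) y t" using that by (simp add: side_def)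
    then have "reachable ?F y t \<and> t \<in> ?K"
    proof (induction rule: reachable_induct)
      case (step v w)
      then have "w \<in> ?K" using reachable_step by (auto simp: side_def)
      moreover have "adjacent ?F v w"
        using step \<open>w \<in> ?K\<close> by (auto simp: adjacent_def induced_edges_def)
      ultimately show ?case using step reachable_step by fast
    qed simp
    then show ?thesis ..
  qed
  have "connected_graph ?K ?F"
    unfolding connected_graph_def
    using side_refl[of y F x] reach by (blast intro: reachable_trans reachable_sym)
  moreover have "simple_graph ?K ?F"
    using simple K finite_subset[OF K finite_nodes] by (auto simp: simple_graph_def induced_edges_def)
  moreover have "\<not> cycle ?K ?F c" for c
    using tree K unfolding tree_def cycle_def induced_edges_def by blast
  ultimately have "tree ?K ?F" by (simp add: tree_def)
  moreover have "subtree ?K ?F (S v)" if "v \<in> V" for v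
  proof -
    have "induced_edges ?F (S v) = induced_edges F (S v)"
      using sub[OF that] by (auto simp: induced_edges_def)
    then show ?thesis using sub[OF that] subtree_S[OF that] by (simp add: subtree_def)
  qed
  ultimately show ?thesis using rep by (simp add: tree_representation_def)
qed

text \<open>Otherwise the side alone would be a host tree, smaller by at least the node
  \<open>x\<close>, against minimality.\<close>

lemma not_all_in_side:
  assumes xy: "adjacent F x y" shows "\<exists>v\<in>V. \<not> S v \<subseteq> side F x y"
proof (rule ccontr)
  assume "\<not> ?thesis"
  then have "tree_representation V E (side F x y) (induced_edges F (side F x y)) S"
    using restrict_to_side[OF xy] by blast
  moreover have "side F x y \<subset> N"
    using side_subset[OF xy] bridge[OF xy] adjacentD[OF xy] by blast
  ultimately show False
    using min_rep psubset_card_mono[OF finite_nodes] unfolding minimal_tree_representation_def by blast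
qed

lemma side_dichotomy:
  assumes xy: "adjacent F x y" and v: "v \<in> V" and "v \<notin> adhesion x y"
  shows "S v \<subseteq> side F x y \<or> S v \<subseteq> side F y x"
  using adhesionI[OF xy v] sides_cover[OF xy] S_subset[OF v] assms(3) by blast

lemma adjacent_same_side:
  assumes xy: "adjacent F x y" and uv: "adjacent E u v"
    and u: "S u \<subseteq> side F x y" and "v \<notin> adhesion x y"
  shows "S v \<subseteq> side F x y"
proof -
  obtain t where t: "v \<in> V" "t \<in> S u" "t \<in> S v" using uv by (rule adjacentE)
  then show ?thesis using side_dichotomy[OF xy t(1) assms(4)] sides_disjoint[OF xy] u by blast
qed

text \<open>By minimality some vertex does not live in \<open>side F y x\<close>. If no subtree used
  both ends of the edge, this vertex would live in \<open>side F x y\<close>, and by connectedness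
  so would all others, again against minimality.\<close>

lemma adhesion_nonempty:
  assumes xy: "adjacent F x y" shows "adhesion x y \<noteq> {}"
proof
  assume A: "adhesion x y = {}"
  have yx: "adjacent F y x" using xy by (simp add: adjacent_sym)
  obtain u where u: "u \<in> V" "S u \<subseteq> side F x y"
    using not_all_in_side[OF yx] side_dichotomy[OF xy] A by blast
  have "S v \<subseteq> side F x y" if "v \<in> V" for v
  proof -
    have "reachable E u v" using connected_G u that by (simp add: connected_graph_def)
    then show ?thesis
      by (induction rule: reachable_induct) (use u A adjacent_same_side[OF xy] in auto)
  qed
  then show False using not_all_in_side[OF xy] by blast
qed

section \<open>Small covers of adhesion sets\<close>

definition covers :: "'a set \<Rightarrow> 'a set \<Rightarrow> 't set \<Rightarrow> bool" where
  "covers W A K \<longleftrightarrow> (\<forall>v\<in>A. \<forall>t\<in>S v \<inter> K. \<exists>w\<in>W. t \<in> S w)"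

text \<open>Recursion away from \<open>x\<close>: the vertices of \<open>A\<close> that pass on to a
  neighbour \<open>z\<close> are covered within the branch at \<open>z\<close>, and leaf counts add
  up over disjoint branches. The set \<open>A\<close> is arbitrary because only part of the adhesion
  set of the next edge comes from \<open>A\<close>.\<close>

lemma cover_exists:
  assumes "adjacent F x y" "A \<subseteq> adhesion x y" "A \<noteq> {}"
  shows "\<exists>W. W \<subseteq> A \<and> W \<noteq> {} \<and> card W \<le> card (leaves N F \<inter> side F x y)
    \<and> covers W A (side F x y)"
  using assms
proof (induction "card (side F x y)" arbitrary: x y A rule: less_induct)
  case less
  note xy = less.prems(1)
  have fin: "finite (side F x y)" using side_subset[OF xy] finite_nodes finite_subset by blast
  let ?A = "\<lambda>z. {v \<in> A. z \<in> S v}"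
  let ?Z = "{z. adjacent F y z \<and> z \<noteq> x \<and> ?A z \<noteq> {}}"
  have A: "v \<in> V" "x \<in> S v" "y \<in> S v" if "v \<in> A" for v
    using less.prems that by (auto simp: adhesion_def)
  have finZ: "finite ?Z"
    by (rule finite_subset[OF _ finite_nodes]) (use adjacentD in blast)
  \<comment> \<open>The subtree of \<open>v\<close> contains \<open>y\<close>, so it can reach
    \<open>t\<close> beyond \<open>y\<close> only through the first node \<open>z\<close> of the
    branch of \<open>t\<close>.\<close>
  have down: "\<exists>z\<in>?Z. v \<in> ?A z \<and> t \<in> side F y z"
    if v: "v \<in> A" and t: "t \<in> S v" "t \<in> side F x y" "t \<noteq> y" for v t
  proof -
    obtain z where z: "adjacent F y z" "z \<noteq> x" "t \<in> side F y z"
      using child_sides_cover[OF xy t(2,3)] .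
    have "z \<in> S v"
      using subtree_crossing(2)[OF z(1) subtree_S[OF A(1)[OF v]] t(1) z(3) A(3)[OF v]] bridge[OF z(1)]
      by simp
    then show ?thesis using z v by blast
  qed
  show ?case
  proof (cases "?Z = {}")
    case True
    \<comment> \<open>No subtree of \<open>A\<close> goes beyond \<open>y\<close>, so one vertex
      covers; the side has a leaf to pay for it.\<close>
    obtain w where w: "w \<in> A" using less.prems by blast
    have "covers {w} A (side F x y)"
      unfolding covers_def
    proof (intro ballI)
      fix v t assume v: "v \<in> A" and t: "t \<in> S v \<inter> side F x y"
      then have "t = y" using down[of v t] True by auto
      then show "\<exists>u\<in>{w}. t \<in> S u" using A(3)[OF w] by simp
    qed
    moreover have "finite (leaves N F \<inter> side F x y)" using fin by simp
    then have "card {w} \<le> card (leaves N F \<inter> side F x y)"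
      using side_has_leaf[OF xy] by (simp add: Suc_le_eq card_gt_0_iff)
    ultimately show ?thesis using w by blast
  next
    case False
    have "\<forall>z\<in>?Z. \<exists>W. W \<subseteq> ?A z \<and> W \<noteq> {} \<and> card W \<le> card (leaves N F \<inter> side F y z)
        \<and> covers W (?A z) (side F y z)"
    proof
      fix z assume z: "z \<in> ?Z"
      then have "side F y z \<subset> side F x y" using side_psubset[OF xy] by blast
      then have "card (side F y z) < card (side F x y)" by (rule psubset_card_mono[OF fin])
      then show "\<exists>W. W \<subseteq> ?A z \<and> W \<noteq> {} \<and> card W \<le> card (leaves N F \<inter> side F y z)
        \<and> covers W (?A z) (side F y z)"
        using z A by (intro less.hyps) (auto simp: adhesion_def)
    qed
    from bchoice[OF this] obtain W where "\<forall>z\<in>?Z. W z \<subseteq> ?A z \<and> W z \<noteq> {}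
        \<and> card (W z) \<le> card (leaves N F \<inter> side F y z) \<and> covers (W z) (?A z) (side F y z)" ..
    then have W: "W z \<subseteq> ?A z" "W z \<noteq> {}" "card (W z) \<le> card (leaves N F \<inter> side F y z)"
        "covers (W z) (?A z) (side F y z)" if "z \<in> ?Z" for z
      using that by simp_all
    let ?W = "\<Union>z\<in>?Z. W z"
    have WA: "?W \<subseteq> A" using W(1) by fastforce
    obtain z0 where "z0 \<in> ?Z" using False by blast
    then have ne: "?W \<noteq> {}" using W(2)[of z0] by blast
    have "card ?W \<le> (\<Sum>z\<in>?Z. card (W z))" by (rule card_UN_le[OF finZ])
    also have "\<dots> \<le> (\<Sum>z\<in>?Z. card (leaves N F \<inter> side F y z))" by (intro sum_mono W(3))
    also have "\<dots> = card (\<Union>z\<in>?Z. leaves N F \<inter> side F y z)"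
    proof (rule card_UN_disjoint[symmetric, OF finZ])
      show "\<forall>z\<in>?Z. finite (leaves N F \<inter> side F y z)"
        using side_mono[OF xy] finite_subset[OF _ fin] by blast
      show "\<forall>z\<in>?Z. \<forall>z'\<in>?Z. z \<noteq> z' \<longrightarrow>
          leaves N F \<inter> side F y z \<inter> (leaves N F \<inter> side F y z') = {}"
        using child_sides_disjoint by blast
    qed
    also have "\<dots> \<le> card (leaves N F \<inter> side F x y)"
      using side_mono[OF xy] fin by (intro card_mono) auto
    finally have "card ?W \<le> card (leaves N F \<inter> side F x y)" .
    moreover have "covers ?W A (side F x y)"
      unfolding covers_def
    proof (intro ballI)
      fix v t assume v: "v \<in> A" and t: "t \<in> S v \<inter> side F x y"
      show "\<exists>w\<in>?W. t \<in> S w"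
      proof (cases "t = y")
        case True
        \<comment> \<open>All of \<open>A\<close> contains \<open>y\<close>, so any member of the
          cover will do; this is why nonemptiness is carried through the induction.\<close>
        obtain w where "w \<in> ?W" using ne by blast
        then show ?thesis using True A(3) WA by blast
      next
        case False
        then obtain z where "z \<in> ?Z" "v \<in> ?A z" "t \<in> side F y z" using down v t by blast
        then show ?thesis using W(4)[of z] t unfolding covers_def by blast
      qed
    qed
    ultimately show ?thesis using WA ne by blast
  qed
qed

subsection \<open>Longest paths on one side of an edge\<close>

text \<open>The certificate for orienting the edge \<open>xy\<close> towards \<open>x\<close>. The
  size of \<open>W\<close> is left out, so that the whole adhesion set may serve as \<open>W\<close>
  as well.\<close>

definition dodges :: "'t \<Rightarrow> 't \<Rightarrow> 'a set \<Rightarrow> 'a list \<Rightarrow> bool" where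
  "dodges x y W Q \<longleftrightarrow> W \<subseteq> adhesion x y \<and> W \<noteq> {} \<and> covers W (adhesion x y) (side F x y)
     \<and> longest_path V E Q \<and> set Q \<inter> W = {} \<and> (\<forall>v\<in>set Q. \<not> S v \<subseteq> side F x y)"

lemma longest_path_subset: "longest_path V E Q \<Longrightarrow> set Q \<subseteq> V"
  and longest_path_successively: "longest_path V E Q \<Longrightarrow> successively (adjacent E) Q"
  and longest_path_nonempty: "longest_path V E Q \<Longrightarrow> Q \<noteq> []"
  by (auto simp: longest_path_def path_def)

lemma symp_adjacent: "symp (adjacent E)"
  by (simp add: symp_def adjacent_sym)

text \<open>If no vertex of \<open>Q\<close> lives inside \<open>side F x y\<close>, then
  \<open>W\<close> and \<open>Q\<close> certify the orientation towards \<open>x\<close>. Otherwise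
  all of them live there, since at a switch a vertex of \<open>W\<close> could be inserted into
  \<open>Q\<close>, and the edge is oriented towards \<open>y\<close>.\<close>

lemma dodging_path:
  assumes xy: "adjacent F x y" and W: "W \<subseteq> adhesion x y" "W \<noteq> {}" "covers W (adhesion x y) (side F x y)"
    and Q: "longest_path V E Q" "set Q \<inter> W = {}"
  shows "(\<exists>W Q. dodges x y W Q) \<or> (\<exists>W Q. dodges y x W Q)"
proof (cases "\<forall>v\<in>set Q. \<not> S v \<subseteq> side F x y")
  case True
  then show ?thesis using assms unfolding dodges_def by blast
next
  case False
  then obtain v0 where v0: "v0 \<in> set Q" "S v0 \<subseteq> side F x y" by blast
  have all: "S v \<subseteq> side F x y" if v: "v \<in> set Q" for v
  proof (rule ccontr)
    assume nv: "\<not> S v \<subseteq> side F x y"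
    obtain xs c d ys where Qeq: "Q = xs @ c # d # ys" and cd: "adjacent E c d"
      and ne: "(S c \<subseteq> side F x y) \<noteq> (S d \<subseteq> side F x y)"
      using successively_exists_change[OF longest_path_successively[OF Q(1)] v0 v nv symp_adjacent]
      by metis
    \<comment> \<open>A node \<open>t\<close> common to \<open>q\<close> and \<open>r\<close> lies
      in the side because \<open>r\<close> lives there; as \<open>q\<close> sticks out, it belongs
      to the adhesion set, and a cover vertex at \<open>t\<close> is adjacent to both.\<close>
    have key: "\<exists>w\<in>W. adjacent E q w \<and> adjacent E w r"
      if qr: "adjacent E q r" "q \<in> set Q" "r \<in> set Q" "S r \<subseteq> side F x y" "\<not> S q \<subseteq> side F x y" for q r
    proof -
      obtain t where t: "q \<in> V" "r \<in> V" "t \<in> S q" "t \<in> S r" using qr(1) by (rule adjacentE)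
      have q: "q \<in> adhesion x y"
        using adjacent_same_side[OF xy, of r q] qr by (auto simp: adjacent_sym)
      then obtain w where w: "w \<in> W" "t \<in> S w" using W(3) t qr(4) unfolding covers_def by blast
      have "w \<in> V" using w W(1) by (auto simp: adhesion_def)
      moreover have "w \<noteq> q" "w \<noteq> r" using w Q(2) qr by auto
      ultimately show ?thesis using w t adjacentI by metis
    qed
    have "\<exists>w\<in>W. adjacent E c w \<and> adjacent E w d"
      using key[of c d] key[of d c] cd ne Qeq by (auto simp: adjacent_sym)
    then obtain w where w: "w \<in> W" "adjacent E c w" "adjacent E w d" by blast
    then have "w \<in> V" using W(1) by (auto simp: adhesion_def)
    then show False using longest_path_no_insert[of V E xs c d ys w] w Q Qeq by blast
  qed
  have yx: "adjacent F y x" using xy by (simp add: adjacent_sym)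
  have sym: "adhesion y x = adhesion x y" by (auto simp: adhesion_def)
  \<comment> \<open>\<open>Q\<close> lives strictly inside \<open>side F x y\<close> and so avoids the whole adhesion set, which covers itself; the
    size of the cover no longer matters.\<close>
  have "dodges y x (adhesion y x) Q"
    unfolding dodges_def
  proof (intro conjI ballI)
    show "covers (adhesion y x) (adhesion y x) (side F y x)" by (auto simp: covers_def)
    show "adhesion y x \<noteq> {}" by (rule adhesion_nonempty[OF yx])
    show "set Q \<inter> adhesion y x = {}"
      using all bridge[OF xy] by (auto simp: adhesion_def)
    fix v assume "v \<in> set Q"
    then show "\<not> S v \<subseteq> side F y x"
      using all[of v] sides_disjoint[OF xy] S_nonempty longest_path_subset[OF Q(1)] by blast
  qed (use Q in auto)
  then show ?thesis by blast
qed

text \<open>On the side with at most \<open>leaf_split\<close> leaves, the cover is too small to be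
  a transversal, so some longest path misses it.\<close>

lemma dodging_orientation:
  assumes xy: "adjacent F x y" and lpt: "leaf_split N F < lpt V E"
  shows "(\<exists>W Q. dodges x y W Q) \<or> (\<exists>W Q. dodges y x W Q)"
proof -
  have *: "(\<exists>W Q. dodges x y W Q) \<or> (\<exists>W Q. dodges y x W Q)"
    if xy: "adjacent F x y" and few: "card (leaves N F \<inter> side F x y) \<le> leaf_split N F" for x y
  proof -
    obtain W where W: "W \<subseteq> adhesion x y" "W \<noteq> {}" "card W \<le> card (leaves N F \<inter> side F x y)"
        "covers W (adhesion x y) (side F x y)"
      using cover_exists[OF xy order.refl adhesion_nonempty[OF xy]] by blast
    have "\<not> longest_path_transversal V E W"
    proof
      assume "longest_path_transversal V E W"
      then have "lpt V E \<le> card W" unfolding lpt_def by (intro Least_le) blast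
      then show False using W(3) few lpt by simp
    qed
    moreover have "W \<subseteq> V" using W(1) by (auto simp: adhesion_def)
    ultimately obtain Q where "longest_path V E Q" "set Q \<inter> W = {}"
      by (auto simp: longest_path_transversal_def)
    then show ?thesis using dodging_path[OF xy] W by blast
  qed
  show ?thesis
    using few_leaves_side[OF xy] *[of x y] *[of y x] xy by (auto simp: adjacent_sym)
qed

text \<open>Without a sink every node has an outgoing \<open>bad\<close> edge. The one with the
  smallest side ahead is followed by another, which does not turn back and hence has a strictly
  smaller side ahead.\<close>

lemma dodging_sink:
  assumes lpt: "leaf_split N F < lpt V E"
  obtains x where "x \<in> N" "\<And>y. adjacent F x y \<Longrightarrow> \<exists>W Q. dodges x y W Q"
proof -
  define bad where "bad x y \<longleftrightarrow> adjacent F x y \<and> \<not> (\<exists>W Q. dodges x y W Q)" for x y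
  have "\<exists>x\<in>N. \<forall>y. \<not> bad x y"
  proof (rule ccontr)
    assume "\<not> ?thesis"
    then have ex: "\<exists>y. bad x y" if "x \<in> N" for x using that by blast
    have "N \<noteq> {}" using connected by (simp add: connected_graph_def)
    then obtain x0 y0 where "bad x0 y0" using ex by blast
    define c where "c = (\<lambda>p. card (side F (fst p) (snd p)))"
    obtain e where e: "bad (fst e) (snd e)" and min: "\<forall>e'. bad (fst e') (snd e') \<longrightarrow> c e \<le> c e'"
      using ex_has_least_nat[of "\<lambda>p. bad (fst p) (snd p)" "(x0, y0)" c] \<open>bad x0 y0\<close> by auto
    define x y where "x = fst e" and "y = snd e"
    have xy: "bad x y" using e by (simp add: x_def y_def)
    have le: "card (side F x y) \<le> card (side F x' y')" if "bad x' y'" for x' y'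
      using min[rule_format, of "(x', y')"] that by (simp add: c_def x_def y_def)
    have adj: "adjacent F x y" using xy by (simp add: bad_def)
    obtain z where yz: "bad y z" using ex adjacentD(2)[OF adj] by blast
    have "\<exists>W Q. dodges y x W Q" using dodging_orientation[OF adj lpt] xy by (auto simp: bad_def)
    then have "z \<noteq> x" using yz by (auto simp: bad_def)
    then have "side F y z \<subset> side F x y" using side_psubset[OF adj] yz by (simp add: bad_def)
    moreover have "finite (side F x y)"
      by (rule finite_subset[OF side_subset[OF adj] finite_nodes])
    ultimately have "card (side F y z) < card (side F x y)" by (simp add: psubset_card_mono)
    then show False using le[OF yz] by simp
  qed
  then show ?thesis using that unfolding bad_def by blast
qed

section \<open>Longest paths around the sink\<close>

lemma avoiding_path_in_side:
  assumes x: "x \<in> N" and p: "p \<noteq> []" "set p \<subseteq> V" "successively (adjacent E) p"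
    and avoid: "\<And>v. v \<in> set p \<Longrightarrow> x \<notin> S v"
  obtains z where "adjacent F x z" "\<And>v. v \<in> set p \<Longrightarrow> S v \<subseteq> side F x z"
proof -
  have h: "hd p \<in> set p" using p by simp
  obtain z where z: "adjacent F x z" "S (hd p) \<subseteq> side F x z"
    using avoiding_subtree_in_side[OF subtree_S x avoid[OF h]] h p by blast
  have "S v \<subseteq> side F x z" if v: "v \<in> set p" for v
  proof (rule ccontr)
    assume nv: "\<not> S v \<subseteq> side F x z"
    obtain xs c d ys where Qeq: "p = xs @ c # d # ys" and cd: "adjacent E c d"
      and ne: "(S c \<subseteq> side F x z) \<noteq> (S d \<subseteq> side F x z)"
      using successively_exists_change[OF p(3) h z(2) v nv symp_adjacent] by metis
    \<comment> \<open>Vertices of the adhesion set contain \<open>x\<close>, so none is on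
      \<open>p\<close>, and consecutive vertices of \<open>p\<close> stay in the same
      branch.\<close>
    have "c \<notin> adhesion x z" "d \<notin> adhesion x z" using avoid Qeq by (auto simp: adhesion_def)
    then show False
      using adjacent_same_side[OF z(1) cd] adjacent_same_side[OF z(1), of d c] cd ne
      by (auto simp: adjacent_sym)
  qed
  then show ?thesis using that z by blast
qed

text \<open>A longest path missing the bag of \<open>x\<close> would live inside one branch, and so
  be disjoint from the longest path that dodges this branch.\<close>

lemma dodging_path_meets_bag:
  assumes x: "x \<in> N" and sink: "\<And>y. adjacent F x y \<Longrightarrow> \<exists>W Q. dodges x y W Q"
    and Q: "longest_path V E Q"
  shows "\<exists>v\<in>set Q. x \<in> S v"
proof (rule ccontr)
  assume "\<not> ?thesis"
  then obtain z where z: "adjacent F x z" and sub: "\<And>v. v \<in> set Q \<Longrightarrow> S v \<subseteq> side F x z"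
    using avoiding_path_in_side[OF x longest_path_nonempty[OF Q] longest_path_subset[OF Q]
      longest_path_successively[OF Q]] by metis
  obtain W Q' where "dodges x z W Q'" using sink[OF z] by blast
  then have "longest_path V E Q'" "\<forall>v\<in>set Q'. \<not> S v \<subseteq> side F x z" by (auto simp: dodges_def)
  then show False using longest_paths_intersect[OF simple_G connected_G Q] sub by blast
qed

lemma no_dodging_sink:
  assumes x: "x \<in> N" and sink: "\<And>y. adjacent F x y \<Longrightarrow> \<exists>W Q. dodges x y W Q"
    and y0: "adjacent F x y0"
  shows False
proof -
  \<comment> \<open>\<open>q\<close> is the first vertex of \<open>Q\<close> whose subtree contains
    \<open>x\<close>, and \<open>p\<close> is the initial segment before it.\<close>
  define start where "start y W Q p q r \<longleftrightarrow> adjacent F x y \<and> dodges x y W Q \<and> Q = p @ q # r \<and> x \<in> S q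
    \<and> (\<forall>v\<in>set p. x \<notin> S v)" for y W Q p q r
  have ex: "\<exists>W Q p q r. start y W Q p q r" if y: "adjacent F x y" for y
  proof -
    obtain W Q where WQ: "dodges x y W Q" using sink[OF y] by blast
    then have "\<exists>v\<in>set Q. x \<in> S v" using dodging_path_meets_bag[OF x sink] by (simp add: dodges_def)
    then obtain p q r where "Q = p @ q # r" "x \<in> S q" "\<forall>v\<in>set p. x \<notin> S v"
      using split_list_first_prop[of Q "\<lambda>v. x \<in> S v"] by auto
    then show ?thesis using y WQ unfolding start_def by blast
  qed
  let ?R = "\<lambda>n. \<exists>y W Q p q r. start y W Q p q r \<and> length p = n"
  have climb: "\<exists>n'>n. ?R n'" if R: "?R n" for n
  proof -
    obtain y W Q p q r where s: "start y W Q p q r" and n: "length p = n" using R by blast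
    have W: "W \<subseteq> adhesion x y" "W \<noteq> {}" "set Q \<inter> W = {}" and Q: "longest_path V E Q"
      and Qeq: "Q = p @ q # r" and q: "x \<in> S q" and av: "\<And>v. v \<in> set p \<Longrightarrow> x \<notin> S v"
      using s by (auto simp: start_def dodges_def)
    have qV: "q \<in> V" and pV: "set p \<subseteq> V" using longest_path_subset[OF Q] Qeq by auto
    have ps: "successively (adjacent E) p"
      using longest_path_successively[OF Q] Qeq by (simp add: successively_append_iff)
    \<comment> \<open>If \<open>Q\<close> started with \<open>q\<close>, a vertex of
      \<open>W\<close> could be prepended: it contains \<open>x\<close> as \<open>q\<close> does,
      and it is not on \<open>Q\<close>.\<close>
    have "p \<noteq> []"
    proof
      assume "p = []"
      obtain w where w: "w \<in> W" using W by blast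
      then have wV: "w \<in> V" "x \<in> S w" "w \<notin> set Q" using W by (auto simp: adhesion_def)
      then have "w \<noteq> q" using Qeq by auto
      then have "adjacent E w q" using adjacentI wV q qV by metis
      then have "path V E (w # Q)"
        using Q wV Qeq \<open>p = []\<close> by (auto simp: longest_path_def path_def successively_Cons)
      then show False using Q unfolding longest_path_def by fastforce
    qed
    obtain z where z: "adjacent F x z" and sub: "\<And>v. v \<in> set p \<Longrightarrow> S v \<subseteq> side F x z"
      using avoiding_path_in_side[OF x \<open>p \<noteq> []\<close> pV ps av] by metis
    obtain W' Q' p' q' r' where s': "start z W' Q' p' q' r'" using ex[OF z] by blast
    have W': "W' \<subseteq> adhesion x z" "covers W' (adhesion x z) (side F x z)" "set Q' \<inter> W' = {}"
      and Q': "longest_path V E Q'" "\<And>v. v \<in> set Q' \<Longrightarrow> \<not> S v \<subseteq> side F x z"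
      and Qeq': "Q' = p' @ q' # r'" and q': "x \<in> S q'"
      using s' by (auto simp: start_def dodges_def)
    have lp: "last p \<in> set p" using \<open>p \<noteq> []\<close> by simp
    have "adjacent E (last p) q"
      using longest_path_successively[OF Q] Qeq \<open>p \<noteq> []\<close> by (simp add: successively_append_iff)
    then obtain t where t: "t \<in> S (last p)" "t \<in> S q" by (rule adjacentE)
    have tz: "t \<in> side F x z" using sub[OF lp] t by blast
    \<comment> \<open>\<open>q\<close> meets \<open>last p\<close> inside the branch at
      \<open>z\<close> and also contains \<open>x\<close>; so \<open>W'\<close> has a vertex
      \<open>w\<close> at the meeting node \<open>t\<close>, and \<open>w\<close> also meets
      \<open>q'\<close> at \<open>x\<close>.\<close>
    have "q \<in> adhesion x z" by (rule adhesionI[OF z qV t(2) tz q bridge[OF z]])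
    then obtain w where w: "w \<in> W'" "t \<in> S w" using W'(2) t tz by (auto simp: covers_def)
    have wV: "w \<in> V" "x \<in> S w" "w \<notin> set Q'" "w \<notin> set p"
      using w W' av by (auto simp: adhesion_def)
    have "last p \<noteq> w" using wV lp by blast
    then have a1: "adjacent E (last p) w" using adjacentI t w wV lp pV by blast
    have q'V: "q' \<in> V" using longest_path_subset[OF Q'(1)] Qeq' by auto
    have "w \<noteq> q'" using wV Qeq' by auto
    then have a2: "adjacent E w q'" using adjacentI q' wV q'V by blast
    have disj: "set p \<inter> set Q' = {}" using sub Q'(2) by blast
    \<comment> \<open>Here \<open>p\<close> followed by \<open>w\<close> replaces \<open>p'\<close>
      in \<open>Q'\<close>. As \<open>Q'\<close> is longest, \<open>length p + 1\<close> is at most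
      \<open>length p'\<close>.\<close>
    have "path V E (p @ w # q' # r')"
      unfolding path_def
    proof (intro conjI)
      show "distinct (p @ w # q' # r')"
        using Q Q'(1) Qeq Qeq' wV disj by (auto simp: longest_path_def path_def)
      show "set (p @ w # q' # r') \<subseteq> V"
        using pV wV longest_path_subset[OF Q'(1)] Qeq' by auto
      show "successively (adjacent E) (p @ w # q' # r')"
        using ps a1 a2 longest_path_successively[OF Q'(1)] Qeq'
        by (auto simp: successively_append_iff successively_Cons)
    qed simp
    then have "length (p @ w # q' # r') \<le> length Q'" using Q'(1) unfolding longest_path_def by blast
    then have "n < length p'" using n Qeq' by simp
    then show ?thesis using s' by blast
  qed
  have "length p \<le> length Q" if "start y W Q p q r" for y W Q p q r
    using that by (simp add: start_def)
  moreover have "length Q \<le> card V" if "start y W Q p q r" for y W Q p q r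
  proof -
    have "distinct Q" "set Q \<subseteq> V"
      using that by (auto simp: start_def dodges_def longest_path_def path_def)
    then show ?thesis using simple_G by (metis card_mono distinct_card simple_graph_def)
  qed
  \<comment> \<open>Segments are parts of paths with distinct vertices in \<open>V\<close>, which
    bounds the lengths that \<open>climb\<close> would raise forever.\<close>
  ultimately have bound: "n \<le> card V" if "?R n" for n using that le_trans by blast
  have "\<exists>n\<ge>k. ?R n" for k
  proof (induction k)
    case 0
    then show ?case using ex[OF y0] by blast
  next
    case (Suc k)
    then obtain n where "n \<ge> k" "?R n" by blast
    then obtain n' where "n' > n" "?R n'" using climb by blast
    moreover have "Suc k \<le> n'" using \<open>n \<ge> k\<close> \<open>n' > n\<close> by simp
    ultimately show ?case by blast
  qed
  then show False using bound by (meson Suc_n_not_le_n le_trans)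
qed

text \<open>A subtree missing \<open>x\<close> would lie in a branch at \<open>x\<close>; without
  branches all subtrees share \<open>x\<close>.\<close>

lemma complete_if_no_edge:
  assumes x: "x \<in> N" and "\<nexists>y. adjacent F x y"
  shows "complete_graph V E"
proof -
  have "x \<in> S v" if "v \<in> V" for v
    using avoiding_subtree_in_side[OF subtree_S[OF that] x] assms(2) by metis
  then show ?thesis using adjacentI by (metis complete_graph_def)
qed

end

theorem theorem5p7:
  fixes V :: "'a set" and E :: "'a set set"
    and N :: "'t set" and F :: "'t set set" and S :: "'a \<Rightarrow> 't set"
  assumes "simple_graph V E"
    and "connected_graph V E"
    and "chordal V E"
    and "minimal_tree_representation V E N F S"
  shows "complete_graph V E \<or> lpt V E \<le> leaf_split N F"
proof (rule ccontr)
  assume contra: "\<not> ?thesis"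
  have "tree N F"
    using assms(4) by (simp add: minimal_tree_representation_def tree_representation_def)
  then interpret represented_graph V E N F S
    using assms
    by (auto simp: represented_graph_def host_tree_def represented_graph_axioms_def)
  \<comment> \<open>A sink with a neighbour is impossible, and one without makes the graph
    complete.\<close>
  obtain x where "x \<in> N" "\<And>y. adjacent F x y \<Longrightarrow> \<exists>W Q. dodges x y W Q"
    using dodging_sink contra by (metis not_le)
  then show False using no_dodging_sink complete_if_no_edge contra by metis
qed

end
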